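(* Let $n\ge 1$ be an integer, let $X$ and $Y$ be metric spaces, and let $f:X\to Y$ be an asymptotically Lipschitz, coarsely surjective map with the following property: there exist $c,d>0$ such that for each $0<r<\infty$ and for each subset $B$ of $Y$ with $\operatorname{diam}(B)\le r$ one has $f^{-1}(B)=\bigcup_{i=1}^nA_i$ for some subsets $A_1,\dots,A_n$ of $X$ with $\operatorname{diam}(A_i)\le cr+d$ for $i=1,\dots,n$. Then $$\operatorname{asdim}_{\mathrm{AN}}Y\le(\operatorname{asdim}_{\mathrm{AN}}X+1)\cdot n-1 .$$
   Context: A map $f:(X,d_X)\to(Y,d_Y)$ is asymptotically Lipschitz if there are $b,c>0$ with $d_Y(f(x),f(x'))\le c\,d_X(x,x')+b$ for all $x,x'\in X$. It is coarsely surjective if there is $R>0$ such that $d_Y(y,f(X))\le R$ for every $y\in Y$. A family $\mathcal U$ of subsets of a metric space is $r$-disjoint if $d(x,x')>r$ for any $x,x'$ belonging to different elements of $\mathcal U$. The asymptotic Assouad-Nagata dimension satisfies $\operatorname{asdim}_{\mathrm{AN}}X\le m$ (with $m\geq 0$ an integer) if there are constants $c,d\ge0$ such that for every $0<r<\infty$ there exist $r$-disjoint families $\mathcal U^0,\dots,\mathcal U^m$ of subsets of $X$ whose union covers $X$ and all of whose elements have diameter at most $cr+d$. $\operatorname{asdim}_{\mathrm{AN}}X$ is the least such $m$, and $\infty$ if there is none (in which case the inequality is trivially true). The sets $A_i$ may be empty or coincide; the empty set has diameter $0$. *)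

theory Defs
  imports "HOL-Analysis.Analysis"
begin

text \<open>Diameters and distances to a set take values in the extended nonnegative reals, so that
  unbounded sets have diameter \<open>\<infinity>\<close>, the empty set has diameter \<open>0\<close>
  and every point has distance \<open>\<infinity>\<close> to the empty set.\<close>

definition mdiam :: "'a metric \<Rightarrow> 'a set \<Rightarrow> ennreal" where
  "mdiam X A = (SUP x\<in>A. SUP y\<in>A. ennreal (mdist X x y))"

definition mdist_set :: "'a metric \<Rightarrow> 'a \<Rightarrow> 'a set \<Rightarrow> ennreal" where
  "mdist_set X x A = (INF y\<in>A. ennreal (mdist X x y))"

definition asymptotically_Lipschitz :: "'a metric \<Rightarrow> 'b metric \<Rightarrow> ('a \<Rightarrow> 'b) \<Rightarrow> bool" where
  "asymptotically_Lipschitz X Y f \<longleftrightarrow>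
     (\<exists>b>0. \<exists>c>0. \<forall>x\<in>mspace X. \<forall>x'\<in>mspace X.
        mdist Y (f x) (f x') \<le> c * mdist X x x' + b)"

definition coarsely_surjective :: "'a metric \<Rightarrow> 'b metric \<Rightarrow> ('a \<Rightarrow> 'b) \<Rightarrow> bool" where
  "coarsely_surjective X Y f \<longleftrightarrow>
     (\<exists>R::real. R > 0 \<and> (\<forall>y\<in>mspace Y. mdist_set Y y (f ` mspace X) \<le> ennreal R))"

definition r_disjoint :: "'a metric \<Rightarrow> real \<Rightarrow> 'a set set \<Rightarrow> bool" where
  "r_disjoint X r \<U> \<longleftrightarrow>
     (\<forall>U\<in>\<U>. \<forall>V\<in>\<U>. U \<noteq> V \<longrightarrow> (\<forall>x\<in>U. \<forall>x'\<in>V. mdist X x x' > r))"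

definition asdim_AN_le :: "'a metric \<Rightarrow> nat \<Rightarrow> bool" where
  "asdim_AN_le X m \<longleftrightarrow>
     (\<exists>c\<ge>0. \<exists>d\<ge>0. \<forall>r>0. \<exists>\<U> :: nat \<Rightarrow> 'a set set.
        (\<forall>i\<le>m. r_disjoint X r (\<U> i) \<and>
           (\<forall>U\<in>\<U> i. U \<subseteq> mspace X \<and> mdiam X U \<le> ennreal (c * r + d))) \<and>
        mspace X = (\<Union>i\<le>m. \<Union>(\<U> i)))"

text \<open>The infimum of the empty set in \<^typ>\<open>enat\<close> is \<open>\<infinity>\<close>.\<close>

definition asdim_AN :: "'a metric \<Rightarrow> enat" where
  "asdim_AN X = Inf {enat m | m. asdim_AN_le X m}"

end

theory Submission
  imports Defs
begin

text \<open>
  Let \<open>X\<close> have dimension at most \<open>m\<close> and put \<open>N = (m + 1) * n\<close>. A ball of radius \<open>T\<close> in \<open>Y\<close> has as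
  preimage a union of \<open>n\<close> sets of diameter at most some \<open>\<rho>\<close>, where \<open>\<rho>\<close> is affine in \<open>T\<close>. If \<open>X\<close>
  is covered by \<open>m + 1\<close> families that are \<open>\<rho>\<close>-disjoint, then each of these \<open>n\<close> sets meets at most
  one element of each family, so the ball meets the images of at most \<open>N\<close> elements of the cover
  (lemma \<open>image_cover_multiplicity\<close>). As \<open>f\<close> is asymptotically Lipschitz the images have diameters
  bounded by an affine function of \<open>\<rho>\<close>, and as \<open>f\<close> is coarsely surjective every point of \<open>Y\<close> is
  within some fixed distance \<open>t\<close> of one of them.

  It remains to turn this cover of multiplicity \<open>N\<close> at scale \<open>T\<close> into \<open>N\<close> families that are
  \<open>r\<close>-disjoint, where \<open>T = t + N * r\<close> (lemma \<open>disjoint_families_of_multiplicity\<close>). Let \<open>S k y\<close> be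
  the set of (indices of) cover elements within distance \<open>t + k * r\<close> of \<open>y\<close>. The sets
  \<open>S 0 y \<subseteq> S 1 y \<subseteq> \<dots> \<subseteq> S N y\<close> are nonempty with at most \<open>N\<close> elements, so two consecutive ones
  coincide; put \<open>y\<close> into the piece \<open>W \<sigma>\<close> if \<open>\<sigma>\<close> is such a repeated value. When \<open>y \<in> W \<sigma>\<close> and
  \<open>y' \<in> W \<tau>\<close> are at distance at most \<open>r\<close>, passing from \<open>y\<close> to \<open>y'\<close> costs one level, and the
  repetition pays for it: one of \<open>\<sigma>\<close>, \<open>\<tau>\<close> contains the other. Hence pieces with index sets of the
  same cardinality are \<open>r\<close>-disjoint, and the \<open>N\<close> possible cardinalities give the \<open>N\<close> families.
  All bounds remain affine in \<open>r\<close>.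
\<close>

section \<open>From covers of bounded multiplicity to disjoint families\<close>

lemma mdiam_le_iff:
  assumes "D \<ge> 0"
  shows "mdiam X A \<le> ennreal D \<longleftrightarrow> (\<forall>x\<in>A. \<forall>y\<in>A. mdist X x y \<le> D)"
  using assms by (auto simp: mdiam_def SUP_le_iff)

lemma mono_sets_repeat:
  fixes S :: "nat \<Rightarrow> 'i set"
  assumes "mono S" "finite (S N)" "card (S N) \<le> N" "S 0 \<noteq> {}"
  shows "\<exists>k<N. S k = S (Suc k)"
proof (rule ccontr)
  assume no_repeat: "\<not> ?thesis"
  have fin: "finite (S k)" if "k \<le> N" for k
    using monoD[OF \<open>mono S\<close> that] \<open>finite (S N)\<close> by (rule finite_subset)
  have "k < card (S k)" if "k \<le> N" for k
    using that
  proof (induction k)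
    case 0
    then show ?case using fin[of 0] \<open>S 0 \<noteq> {}\<close> by (simp add: card_gt_0_iff)
  next
    case (Suc k)
    have "S k \<subset> S (Suc k)"
      using no_repeat Suc.prems monoD[OF \<open>mono S\<close>, of k "Suc k"] by auto
    then have "card (S k) < card (S (Suc k))"
      using fin[OF Suc.prems] by (simp add: psubset_card_mono)
    with Suc show ?case by simp
  qed
  from this[of N] \<open>card (S N) \<le> N\<close> show False by simp
qed

text \<open>
  This replaces the usual passage through the nerve of the cover. The pieces \<open>W \<sigma>\<close> play the part
  of the stars of the barycenters of the simplices \<open>\<sigma>\<close>, sorted by the dimension of \<open>\<sigma>\<close>.
\<close>

lemma disjoint_families_of_multiplicity:
  fixes Y :: "'b metric" and V :: "'i \<Rightarrow> 'b set"
  assumes r: "r > 0" and t: "t \<ge> 0" and D: "D \<ge> 0"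
    and V: "\<And>i. i \<in> I \<Longrightarrow> V i \<subseteq> mspace Y"
    and diam: "\<And>i v w. i \<in> I \<Longrightarrow> v \<in> V i \<Longrightarrow> w \<in> V i \<Longrightarrow> mdist Y v w \<le> D"
    and near: "\<And>y. y \<in> mspace Y \<Longrightarrow> \<exists>i\<in>I. \<exists>v\<in>V i. mdist Y y v \<le> t"
    and mult: "\<And>y. y \<in> mspace Y \<Longrightarrow>
      finite {i \<in> I. \<exists>v\<in>V i. mdist Y y v \<le> t + real N * r} \<and>
      card {i \<in> I. \<exists>v\<in>V i. mdist Y y v \<le> t + real N * r} \<le> N"
  shows "\<exists>\<U> :: nat \<Rightarrow> 'b set set.
    (\<forall>k<N. r_disjoint Y r (\<U> k) \<and>
       (\<forall>U\<in>\<U> k. U \<subseteq> mspace Y \<and> mdiam Y U \<le> ennreal (D + 2 * (t + real N * r)))) \<and>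
    mspace Y = (\<Union>k<N. \<Union>(\<U> k))"
proof -
  define S where "S k y = {i \<in> I. \<exists>v\<in>V i. mdist Y y v \<le> t + real k * r}" for k :: nat and y
  define W where "W \<sigma> = {y \<in> mspace Y. \<exists>k<N. S k y = \<sigma> \<and> S (Suc k) y = \<sigma>}" for \<sigma>
  \<comment> \<open>The cardinality \<open>Suc k\<close>: repeated values are nonempty, because \<open>S 0 y\<close> is.\<close>
  define \<U> where "\<U> k = {W \<sigma> |\<sigma>. finite \<sigma> \<and> card \<sigma> = Suc k}" for k
  have mono_S: "mono (\<lambda>k. S k y)" for y
  proof (rule monoI)
    fix k l :: nat assume "k \<le> l"
    then have "t + real k * r \<le> t + real l * r" using r by (simp add: mult_right_mono)
    then show "S k y \<subseteq> S l y" unfolding S_def by (blast intro: order_trans)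
  qed
  have move: "S k y \<subseteq> S (Suc k) y'"
    if "y \<in> mspace Y" "y' \<in> mspace Y" "mdist Y y y' \<le> r" for k y y'
  proof
    fix i assume "i \<in> S k y"
    then obtain v where v: "i \<in> I" "v \<in> V i" "mdist Y y v \<le> t + real k * r"
      unfolding S_def by blast
    have "mdist Y y' v \<le> mdist Y y' y + mdist Y y v"
      using that v V by (intro mdist_triangle) auto
    also have "\<dots> \<le> t + real (Suc k) * r"
      using that v mdist_commute[of Y y y'] by (simp add: algebra_simps)
    finally show "i \<in> S (Suc k) y'" using v unfolding S_def by blast
  qed
  \<comment> \<open>The level at which \<open>\<tau>\<close> repeats is the higher one, so it absorbs the step from \<open>y\<close> to \<open>y'\<close>.\<close>
  have comparable: "\<sigma> \<subseteq> \<tau>"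
    if "y \<in> mspace Y" "y' \<in> mspace Y" "mdist Y y y' \<le> r"
      "S k y = \<sigma>" "S (Suc l) y' = \<tau>" "k \<le> l" for y y' k l \<sigma> \<tau>
    using move[OF that(1-3), of k] monoD[OF mono_S, of "Suc k" "Suc l" y'] that(4-6) by blast
  have disjoint: "r_disjoint Y r (\<U> k)" for k
    unfolding r_disjoint_def
  proof (intro ballI impI)
    fix A B y y' assume AB: "A \<in> \<U> k" "B \<in> \<U> k" "A \<noteq> B" and y: "y \<in> A" "y' \<in> B"
    from AB(1) obtain \<sigma> where A: "A = W \<sigma>" and \<sigma>: "finite \<sigma>" "card \<sigma> = Suc k"
      unfolding \<U>_def by blast
    from AB(2) obtain \<tau> where B: "B = W \<tau>" and \<tau>: "finite \<tau>" "card \<tau> = Suc k"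
      unfolding \<U>_def by blast
    from y A B obtain p q where
      p: "y \<in> mspace Y" "S p y = \<sigma>" "S (Suc p) y = \<sigma>" and
      q: "y' \<in> mspace Y" "S q y' = \<tau>" "S (Suc q) y' = \<tau>"
      unfolding W_def by blast
    show "mdist Y y y' > r"
    proof (rule ccontr)
      assume "\<not> mdist Y y y' > r"
      then have le: "mdist Y y y' \<le> r" "mdist Y y' y \<le> r" by (simp_all add: mdist_commute)
      have "\<sigma> \<subseteq> \<tau> \<or> \<tau> \<subseteq> \<sigma>"
        using comparable[OF p(1) q(1) le(1) p(2) q(3)] comparable[OF q(1) p(1) le(2) q(2) p(3)]
        by linarith
      then have "\<sigma> = \<tau>" using \<sigma> \<tau> by (metis card_subset_eq)
      with AB A B show False by simp
    qed
  qed
  have T: "0 \<le> t + real N * r" using r t by simp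
  have bounded: "mdiam Y (W \<sigma>) \<le> ennreal (D + 2 * (t + real N * r))" if nonempty: "\<sigma> \<noteq> {}" for \<sigma>
  proof -
    obtain i where i: "i \<in> \<sigma>" using nonempty by blast
    have close: "i \<in> I \<and> (\<exists>v\<in>V i. mdist Y y v \<le> t + real N * r)" if "y \<in> W \<sigma>" for y
    proof -
      from that obtain k where "k < N" "S k y = \<sigma>" unfolding W_def by blast
      then have "i \<in> S N y" using i monoD[OF mono_S, of k N y] by auto
      then show ?thesis by (simp add: S_def)
    qed
    have "mdist Y y y' \<le> D + 2 * (t + real N * r)" if W: "y \<in> W \<sigma>" "y' \<in> W \<sigma>" for y y'
    proof -
      from close[OF W(1)] close[OF W(2)] obtain v w where I: "i \<in> I"
        and v: "v \<in> V i" "mdist Y y v \<le> t + real N * r"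
        and w: "w \<in> V i" "mdist Y y' w \<le> t + real N * r" by blast
      have Y: "y \<in> mspace Y" "y' \<in> mspace Y" "v \<in> mspace Y" "w \<in> mspace Y"
        using W v w V[OF I] by (auto simp: W_def)
      show ?thesis
        using mdist_triangle[OF Y(1,3,2)] mdist_triangle[OF Y(3,4,2)] diam[OF I v(1) w(1)]
          v(2) w(2) mdist_commute[of Y w y'] unfolding mult_2 by linarith
    qed
    then show ?thesis using D T by (subst mdiam_le_iff) auto
  qed
  have cover: "\<exists>k<N. y \<in> \<Union>(\<U> k)" if y: "y \<in> mspace Y" for y
  proof -
    have fin: "finite (S N y)" and card: "card (S N y) \<le> N"
      using mult[OF y] by (simp_all add: S_def)
    have S0: "S 0 y \<noteq> {}" using near[OF y] by (auto simp: S_def)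
    from mono_sets_repeat[OF mono_S fin card S0]
    obtain k where k: "k < N" "S k y = S (Suc k) y" by blast
    have sub: "S 0 y \<subseteq> S k y" "S k y \<subseteq> S N y" using k monoD[OF mono_S] by auto
    have fink: "finite (S k y)" using sub(2) fin by (rule finite_subset)
    then have pos: "0 < card (S k y)" using sub(1) S0 by (auto simp: card_gt_0_iff)
    have le: "card (S k y) \<le> N" using card_mono[OF fin sub(2)] card by simp
    have "y \<in> W (S k y)" using y k by (auto simp: W_def)
    then have "y \<in> \<Union>(\<U> (card (S k y) - 1))" using fink pos by (auto simp: \<U>_def)
    then show ?thesis using pos le by (intro exI[of _ "card (S k y) - 1"]) auto
  qed
  have sub: "U \<subseteq> mspace Y" and diam_U: "mdiam Y U \<le> ennreal (D + 2 * (t + real N * r))"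
    if "U \<in> \<U> k" for U k
  proof -
    from that obtain \<sigma> where U: "U = W \<sigma>" "card \<sigma> = Suc k" unfolding \<U>_def by blast
    then show "U \<subseteq> mspace Y" unfolding W_def by blast
    have "\<sigma> \<noteq> {}" using U(2) by auto
    then show "mdiam Y U \<le> ennreal (D + 2 * (t + real N * r))" unfolding U(1) by (rule bounded)
  qed
  have "mspace Y = (\<Union>k<N. \<Union>(\<U> k))" using cover sub by blast
  with disjoint sub diam_U show ?thesis by (intro exI[of _ \<U>] conjI allI impI ballI)
qed

section \<open>Images of covers under coarsely finite-to-one maps\<close>

text \<open>
  A member of the cover that meets \<open>P\<close> is determined by a family \<open>\<U> j\<close> that contains it and a
  piece \<open>A i\<close> that it meets, because two members of the same \<rho>-disjoint family cannot both meet a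
  set of diameter at most \<open>\<rho>\<close>.
\<close>

lemma image_cover_multiplicity:
  fixes X :: "'a metric" and \<U> :: "nat \<Rightarrow> 'a set set"
  assumes disj: "\<And>j. j \<le> m \<Longrightarrow> r_disjoint X \<rho> (\<U> j)"
    and P: "P \<subseteq> (\<Union>i\<in>{1..n}. A i)"
    and diam: "\<And>i x x'. i \<in> {1..n} \<Longrightarrow> x \<in> A i \<Longrightarrow> x' \<in> A i \<Longrightarrow> mdist X x x' \<le> \<rho>"
  shows "finite {U \<in> (\<Union>j\<le>m. \<U> j). U \<inter> P \<noteq> {}} \<and>
    card {U \<in> (\<Union>j\<le>m. \<U> j). U \<inter> P \<noteq> {}} \<le> (m + 1) * n"
proof -
  let ?M = "{U \<in> (\<Union>j\<le>m. \<U> j). U \<inter> P \<noteq> {}}" and ?J = "{..m} \<times> {1..n}"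
  define g where "g U = (SOME (j, i). (j, i) \<in> ?J \<and> U \<in> \<U> j \<and> U \<inter> A i \<noteq> {})" for U
  have g: "g U \<in> ?J \<and> U \<in> \<U> (fst (g U)) \<and> U \<inter> A (snd (g U)) \<noteq> {}" if U: "U \<in> ?M" for U
  proof -
    obtain j x where "j \<le> m" "U \<in> \<U> j" "x \<in> U" "x \<in> P" using U by auto
    moreover obtain i where "i \<in> {1..n}" "x \<in> A i" using P \<open>x \<in> P\<close> by blast
    ultimately have "case (j, i) of (j, i) \<Rightarrow> (j, i) \<in> ?J \<and> U \<in> \<U> j \<and> U \<inter> A i \<noteq> {}" by auto
    then have "case g U of (j, i) \<Rightarrow> (j, i) \<in> ?J \<and> U \<in> \<U> j \<and> U \<inter> A i \<noteq> {}"
      unfolding g_def by (rule someI)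
    then show ?thesis by (simp add: case_prod_unfold mem_Times_iff)
  qed
  have "inj_on g ?M"
  proof (rule inj_onI)
    fix U U' assume U: "U \<in> ?M" "U' \<in> ?M" and eq: "g U = g U'"
    obtain j i where ji: "g U = (j, i)" by (cases "g U")
    have *: "j \<le> m" "i \<in> {1..n}" "U \<in> \<U> j" "U' \<in> \<U> j" "U \<inter> A i \<noteq> {}" "U' \<inter> A i \<noteq> {}"
      using g[OF U(1)] g[OF U(2)] eq ji by auto
    then obtain x x' where x: "x \<in> U" "x \<in> A i" "x' \<in> U'" "x' \<in> A i" by blast
    have "mdist X x x' \<le> \<rho>" using diam *(2) x by blast
    then show "U = U'" using disj[OF *(1)] * x unfolding r_disjoint_def by (meson not_le)
  qed
  moreover have "g ` ?M \<subseteq> ?J" using g by blast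
  moreover have "finite ?J" by simp
  ultimately have "finite ?M" "card ?M \<le> card ?J"
    by (rule inj_on_finite, rule card_inj_on_le)
  then show ?thesis by simp
qed

section \<open>The dimension of the target\<close>

lemma coarsely_surjectiveD:
  assumes "coarsely_surjective X Y f"
  obtains t where "t > 0" "\<And>y. y \<in> mspace Y \<Longrightarrow> \<exists>x\<in>mspace X. mdist Y y (f x) \<le> t"
proof -
  from assms obtain R where R: "R > 0"
    "\<And>y. y \<in> mspace Y \<Longrightarrow> mdist_set Y y (f ` mspace X) \<le> ennreal R"
    unfolding coarsely_surjective_def by blast
  \<comment> \<open>The distance to the image need not be attained, so the radius is enlarged by one.\<close>
  have "\<exists>x\<in>mspace X. mdist Y y (f x) \<le> R + 1" if "y \<in> mspace Y" for y
  proof -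
    have "mdist_set Y y (f ` mspace X) < ennreal (R + 1)"
      using R(2)[OF that] R(1) by (simp add: order_le_less_trans ennreal_less_iff)
    then obtain x where "x \<in> mspace X" "ennreal (mdist Y y (f x)) < ennreal (R + 1)"
      unfolding mdist_set_def by (auto simp: INF_less_iff)
    then show ?thesis using R(1)
      by (auto simp: ennreal_less_iff simp del: ennreal_plus intro!: bexI[of _ x])
  qed
  with R(1) show ?thesis by (intro that[of "R + 1"]) auto
qed

lemma asdim_AN_le_image:
  fixes X :: "'a metric" and Y :: "'b metric"
  assumes n: "n \<ge> 1" and f: "f \<in> mspace X \<rightarrow> mspace Y"
    and lip: "asymptotically_Lipschitz X Y f" and surj: "coarsely_surjective X Y f"
    and fib: "\<exists>c>0. \<exists>d>0. \<forall>r>0. \<forall>B. B \<subseteq> mspace Y \<and> mdiam Y B \<le> ennreal r \<longrightarrow>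
           (\<exists>A :: nat \<Rightarrow> 'a set.
              (\<forall>i\<in>{1..n}. A i \<subseteq> mspace X \<and> mdiam X (A i) \<le> ennreal (c * r + d)) \<and>
              {x \<in> mspace X. f x \<in> B} = (\<Union>i\<in>{1..n}. A i))"
    and X: "asdim_AN_le X m"
  shows "asdim_AN_le Y ((m + 1) * n - 1)"
proof -
  define N where "N = (m + 1) * n"
  have N: "N > 0" using n by (simp add: N_def)
  obtain t where t: "t > 0" "\<And>y. y \<in> mspace Y \<Longrightarrow> \<exists>x\<in>mspace X. mdist Y y (f x) \<le> t"
    using coarsely_surjectiveD[OF surj] by blast
  from lip obtain b l where b: "b > 0" and l: "l > 0" and lip':
    "\<And>x x'. x \<in> mspace X \<Longrightarrow> x' \<in> mspace X \<Longrightarrow> mdist Y (f x) (f x') \<le> l * mdist X x x' + b"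
    unfolding asymptotically_Lipschitz_def by blast
  from fib obtain c d where c: "c > 0" and d: "d > 0" and fib':
    "\<forall>r>0. \<forall>B. B \<subseteq> mspace Y \<and> mdiam Y B \<le> ennreal r \<longrightarrow>
       (\<exists>A :: nat \<Rightarrow> 'a set.
         (\<forall>i\<in>{1..n}. A i \<subseteq> mspace X \<and> mdiam X (A i) \<le> ennreal (c * r + d)) \<and>
         {x \<in> mspace X. f x \<in> B} = (\<Union>i\<in>{1..n}. A i))"
    by (elim exE conjE)
  from X obtain cX dX where cX: "cX \<ge> 0" and dX: "dX \<ge> 0" and covX:
    "\<And>r. r > 0 \<Longrightarrow> \<exists>\<U> :: nat \<Rightarrow> 'a set set.
        (\<forall>i\<le>m. r_disjoint X r (\<U> i) \<and>
           (\<forall>U\<in>\<U> i. U \<subseteq> mspace X \<and> mdiam X U \<le> ennreal (cX * r + dX))) \<and>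
        mspace X = (\<Union>i\<le>m. \<Union>(\<U> i))"
    unfolding asdim_AN_le_def by blast
  \<comment> \<open>The radius of the balls in \<open>Y\<close>, the scale of the cover of \<open>X\<close> and the diameter of the images
      of its members depend affinely on \<open>r\<close>; \<open>c'\<close> and \<open>d'\<close> are the coefficients of \<open>D r + 2 * T r\<close>.\<close>
  define T where "T r = t + real N * r" for r :: real
  define \<rho> where "\<rho> r = c * (2 * T r) + d" for r
  define D where "D r = l * (cX * \<rho> r + dX) + b" for r
  define c' where "c' = l * cX * c * 2 * real N + 2 * real N"
  define d' where "d' = l * (cX * (c * 2 * t + d) + dX) + b + 2 * t"
  have affine: "D r + 2 * (t + real N * r) = c' * r + d'" for r
    by (simp add: D_def \<rho>_def T_def c'_def d'_def algebra_simps)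
  have nonneg: "c' \<ge> 0" "d' \<ge> 0"
    using b l c d cX dX t by (simp_all add: c'_def d'_def)
  have main: "\<exists>\<V> :: nat \<Rightarrow> 'b set set.
      (\<forall>k<N. r_disjoint Y r (\<V> k) \<and>
         (\<forall>U\<in>\<V> k. U \<subseteq> mspace Y \<and> mdiam Y U \<le> ennreal (c' * r + d'))) \<and>
      mspace Y = (\<Union>k<N. \<Union>(\<V> k))" if r: "r > 0" for r
  proof -
    have T: "T r > 0" using r t by (simp add: T_def add_pos_nonneg)
    have \<rho>: "\<rho> r > 0" using c d T by (simp add: \<rho>_def add_pos_pos)
    have D: "D r \<ge> 0" using l cX dX b \<rho> by (simp add: D_def)
    from covX[OF \<rho>] obtain \<U> :: "nat \<Rightarrow> 'a set set" where
      \<U>: "(\<forall>j\<le>m. r_disjoint X (\<rho> r) (\<U> j) \<and>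
           (\<forall>U\<in>\<U> j. U \<subseteq> mspace X \<and> mdiam X U \<le> ennreal (cX * \<rho> r + dX))) \<and>
        mspace X = (\<Union>j\<le>m. \<Union>(\<U> j))"
      by (elim exE)
    then have disj: "\<And>j. j \<le> m \<Longrightarrow> r_disjoint X (\<rho> r) (\<U> j)"
      and sub: "\<And>j U. j \<le> m \<Longrightarrow> U \<in> \<U> j \<Longrightarrow> U \<subseteq> mspace X"
      and diam: "\<And>j U. j \<le> m \<Longrightarrow> U \<in> \<U> j \<Longrightarrow> mdiam X U \<le> ennreal (cX * \<rho> r + dX)"
      and cov: "mspace X = (\<Union>j\<le>m. \<Union>(\<U> j))"
      by blast+
    let ?I = "\<Union>j\<le>m. \<U> j"
    have mult: "finite {U \<in> ?I. \<exists>v\<in>f ` U. mdist Y y v \<le> t + real N * r} \<and>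
        card {U \<in> ?I. \<exists>v\<in>f ` U. mdist Y y v \<le> t + real N * r} \<le> N"
      if y: "y \<in> mspace Y" for y
    proof -
      define B where "B = {v \<in> mspace Y. mdist Y y v \<le> T r}"
      have "mdist Y v w \<le> 2 * T r" if "v \<in> B" "w \<in> B" for v w
        using that y mdist_triangle[of v Y y w] mdist_commute[of Y v y] by (auto simp: B_def)
      then have "mdiam Y B \<le> ennreal (2 * T r)" using T by (subst mdiam_le_iff) auto
      moreover have "B \<subseteq> mspace Y" "2 * T r > 0" using T by (auto simp: B_def)
      ultimately have "\<exists>A :: nat \<Rightarrow> 'a set.
          (\<forall>i\<in>{1..n}. A i \<subseteq> mspace X \<and> mdiam X (A i) \<le> ennreal (\<rho> r)) \<and>
          {x \<in> mspace X. f x \<in> B} = (\<Union>i\<in>{1..n}. A i)"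
        using fib' unfolding \<rho>_def by simp
      then obtain A :: "nat \<Rightarrow> 'a set" where
        A: "\<forall>i\<in>{1..n}. A i \<subseteq> mspace X \<and> mdiam X (A i) \<le> ennreal (\<rho> r)"
        and pre: "{x \<in> mspace X. f x \<in> B} = (\<Union>i\<in>{1..n}. A i)"
        by (elim exE conjE)
      have "mdist X x x' \<le> \<rho> r" if "i \<in> {1..n}" "x \<in> A i" "x' \<in> A i" for i x x'
        using bspec[OF A that(1)] that \<rho> by (simp add: mdiam_le_iff)
      note count = image_cover_multiplicity[of m X "\<rho> r" \<U>, OF disj equalityD1[OF pre] this]
      have "{U \<in> ?I. \<exists>v\<in>f ` U. mdist Y y v \<le> t + real N * r} =
          {U \<in> ?I. U \<inter> {x \<in> mspace X. f x \<in> B} \<noteq> {}}"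
        using sub f by (fastforce simp: B_def T_def)
      then show ?thesis using count by (simp add: N_def)
    qed
    have near: "\<exists>U\<in>?I. \<exists>v\<in>f ` U. mdist Y y v \<le> t" if "y \<in> mspace Y" for y
      using t(2)[OF that] cov by blast
    have V: "f ` U \<subseteq> mspace Y" if "U \<in> ?I" for U using that sub f by blast
    have dV: "mdist Y v w \<le> D r" if U: "U \<in> ?I" "v \<in> f ` U" "w \<in> f ` U" for U v w
    proof -
      from U obtain x x' where x: "x \<in> U" "v = f x" "x' \<in> U" "w = f x'" by blast
      have "cX * \<rho> r + dX \<ge> 0" using cX dX \<rho> by simp
      then have "mdist X x x' \<le> cX * \<rho> r + dX"
        using U(1) diam x(1,3) by (auto simp: mdiam_le_iff)
      then have "l * mdist X x x' \<le> l * (cX * \<rho> r + dX)" using l by simp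
      moreover have "x \<in> mspace X" "x' \<in> mspace X" using x U(1) sub by blast+
      ultimately show ?thesis using lip'[of x x'] x by (simp add: D_def)
    qed
    show ?thesis
      using disjoint_families_of_multiplicity[where V = "(`) f" and I = ?I and D = "D r" and N = N,
          OF r less_imp_le[OF t(1)] D V dV near mult]
      unfolding affine .
  qed
  \<comment> \<open>Dimension at most \<open>N - 1\<close> allows \<open>N\<close> families; \<open>N > 0\<close> rules out truncated subtraction.\<close>
  have N': "{..<N} = {..N - 1}" "\<And>k. k < N \<longleftrightarrow> k \<le> N - 1" using N by auto
  show ?thesis
    unfolding asdim_AN_le_def N_def[symmetric]
    by (rule exI[of _ c'], rule conjI[OF nonneg(1)], rule exI[of _ d'], rule conjI[OF nonneg(2)])
      (use main[unfolded N'] in simp)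
qed

lemma asdim_AN_le_asdim_AN:
  assumes "asdim_AN X = enat m"
  shows "asdim_AN_le X m"
proof -
  let ?S = "{enat k | k. asdim_AN_le X k}"
  have "?S \<noteq> {}" using assms by (metis asdim_AN_def Inf_enat_def enat.distinct(1))
  then have "Inf ?S \<in> ?S" using wellorder_InfI by (meson ex_in_conv)
  then show ?thesis using assms by (auto simp: asdim_AN_def)
qed

theorem theorem1p6:
  fixes n :: nat and X :: "'a metric" and Y :: "'b metric" and f :: "'a \<Rightarrow> 'b"
  assumes "n \<ge> 1"
    and "f \<in> mspace X \<rightarrow> mspace Y"
    and "asymptotically_Lipschitz X Y f"
    and "coarsely_surjective X Y f"
    and "\<exists>c>0. \<exists>d>0. \<forall>r>0. \<forall>B. B \<subseteq> mspace Y \<and> mdiam Y B \<le> ennreal r \<longrightarrow>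
           (\<exists>A :: nat \<Rightarrow> 'a set.
              (\<forall>i\<in>{1..n}. A i \<subseteq> mspace X \<and> mdiam X (A i) \<le> ennreal (c * r + d)) \<and>
              {x \<in> mspace X. f x \<in> B} = (\<Union>i\<in>{1..n}. A i))"
  shows "asdim_AN Y \<le> (asdim_AN X + 1) * enat n - 1"
proof (cases "asdim_AN X")
  case (enat m)
  have "asdim_AN_le Y ((m + 1) * n - 1)"
    using asdim_AN_le_image[OF assms asdim_AN_le_asdim_AN[OF enat]] .
  then have "asdim_AN Y \<le> enat ((m + 1) * n - 1)"
    unfolding asdim_AN_def by (intro Inf_lower) blast
  also have "\<dots> = (asdim_AN X + 1) * enat n - 1"
    by (simp add: enat one_enat_def)
  finally show ?thesis .
next
  case infinity
  then show ?thesis using \<open>n \<ge> 1\<close> by (simp add: imult_is_infinity one_enat_def enat_0_iff)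
qed

end
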